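(* Let $(\phi_t)$ be a hyperbolic semigroup in $\mathbb{D}$ which induces the semigroup of composition operators $(T_t)$. Suppose that $\Omega$ is the Koenigs domain of $(\phi_t)$ and $\psi_\Omega:(a,b)\to[-\infty,+\infty)$ its defining function, where $-\infty<a<b<+\infty$. If $\sigma_{\mathcal{D}}$ is the point spectrum of the infinitesimal generator of $(T_t)$ when acting on the Dirichlet space $\mathcal{D}$, then: (a) It holds that $\lambda\in\sigma_{\mathcal{D}}\setminus\{0\}$ if and only if $\int_a^b e^{2\,\mathrm{Re}\lambda\,\psi_\Omega(y)}\,dy<+\infty$. Set $c_\Omega=\inf\{c\in(-\infty,0]:\int_a^b e^{2c\psi_\Omega(y)}\,dy<+\infty\}$. Then: (b) If $c_\Omega=0$, then $\sigma_{\mathcal{D}}=\{0\}$. (c) If $c_\Omega\in(-\infty,0)$ and $\int_a^b e^{2c_\Omega\psi_\Omega(y)}\,dy=+\infty$, then $\sigma_{\mathcal{D}}=\{\lambda\in\mathbb{C}:c_\Omega<\mathrm{Re}\,\lambda<0\}\cup\{0\}$. (d) If $c_\Omega\in(-\infty,0)$ and $\int_a^b e^{2c_\Omega\psi_\Omega(y)}\,dy<+\infty$, then $\sigma_{\mathcal{D}}=\{\lambda\in\mathbb{C}:c_\Omega\le\mathrm{Re}\,\lambda<0\}\cup\{0\}$. (e) If $c_\Omega=-\infty$, then $\sigma_{\mathcal{D}}=\{\lambda\in\mathbb{C}:-\infty<\mathrm{Re}\,\lambda<0\}\cup\{0\}$.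
   Context: $\mathbb{D}$ is the open unit disk. A semigroup in $\mathbb{D}$ is a family $(\phi_t)_{t\ge0}$ of holomorphic maps $\phi_t:\mathbb{D}\to\mathbb{D}$ with $\phi_0=\mathrm{id}$, $\phi_{t+s}=\phi_t\circ\phi_s$ for all $t,s\ge0$, and $\phi_t(z)\to z$ uniformly on compacta as $t\to0^+$. It is non-elliptic if there is $\tau\in\partial\mathbb{D}$ (the Denjoy–Wolff point) with $\phi_t(z)\to\tau$ as $t\to+\infty$ for all $z\in\mathbb{D}$; a non-elliptic semigroup is hyperbolic if the angular derivative satisfies $\phi_1'(\tau)\in(0,1)$. For a non-elliptic semigroup there is a univalent map $h:\mathbb{D}\to\mathbb{C}$, unique up to translation, the Koenigs function, with $h(\phi_t(z))=h(z)+t$ for all $t\ge0$, $z\in\mathbb{D}$; $\Omega:=h(\mathbb{D})$ is the Koenigs domain. The defining function is the unique upper semi-continuous function $\psi_\Omega:I\to[-\infty,+\infty)$, $I\subseteq\mathbb{R}$ an open interval, such that $\Omega=\{x+iy:y\in I,\ x>\psi_\Omega(y)\}$; for hyperbolic semigroups $I=(a,b)$ is bounded. The Dirichlet space $\mathcal{D}$ is the space of holomorphic $f:\mathbb{D}\to\mathbb{C}$ with $\int_{\mathbb{D}}|f'(z)|^2\,dA(z)<+\infty$ ($dA$ normalized area measure), with its usual norm. $T_t(f)=f\circ\phi_t$, $f\in\mathcal{D}$, is a strongly continuous semigroup of bounded operators; its infinitesimal generator is $\Gamma_{\mathcal{D}}(f)=\lim_{t\to0^+}(T_t(f)-f)/t$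 (norm limit), defined on those $f\in\mathcal{D}$ for which the limit exists in $\mathcal{D}$. The point spectrum is the set of eigenvalues $\lambda\in\mathbb{C}$ of $\Gamma_{\mathcal{D}}$, i.e. those for which $\Gamma_{\mathcal{D}}(f)=\lambda f$ has a non-trivial solution $f$.
   Formalization: In (a) the condition Re λ < 0 is added next to finiteness of the integral; without it the equivalence fails, e.g. for λ = 0 the integral equals b − a < +∞ although 0 is not in σ_D∖{0}. *)

theory Defs
  imports "HOL-Complex_Analysis.Complex_Analysis"
begin

section \<open>Semigroups of holomorphic self-maps of the unit disk\<close>

text \<open>Families indexed by \<open>t \<ge> 0\<close> are functions on all of \<^typ>\<open>real\<close>, and functions on the
  unit disk are functions on all of \<^typ>\<open>complex\<close>; only the values at \<open>t \<ge> 0\<close> and on the disk matter.\<close>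

abbreviation unit_disk :: "complex set" where
  "unit_disk \<equiv> ball 0 1"

definition holo_semigroup :: "(real \<Rightarrow> complex \<Rightarrow> complex) \<Rightarrow> bool" where
  "holo_semigroup \<phi> \<longleftrightarrow>
     (\<forall>t\<ge>0. \<phi> t holomorphic_on unit_disk \<and> \<phi> t ` unit_disk \<subseteq> unit_disk) \<and>
     (\<forall>z\<in>unit_disk. \<phi> 0 z = z) \<and>
     (\<forall>s\<ge>0. \<forall>t\<ge>0. \<forall>z\<in>unit_disk. \<phi> (t + s) z = \<phi> t (\<phi> s z)) \<and>
     (\<forall>K. compact K \<and> K \<subseteq> unit_disk \<longrightarrow> uniform_limit K \<phi> (\<lambda>z. z) (at_right 0))"

definition denjoy_wolff_point :: "(real \<Rightarrow> complex \<Rightarrow> complex) \<Rightarrow> complex \<Rightarrow> bool" where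
  "denjoy_wolff_point \<phi> \<tau> \<longleftrightarrow>
     \<tau> \<in> sphere 0 1 \<and> (\<forall>z\<in>unit_disk. ((\<lambda>t. \<phi> t z) \<longlongrightarrow> \<tau>) at_top)"

definition stolz_angle :: "complex \<Rightarrow> real \<Rightarrow> complex set" where
  "stolz_angle \<tau> M = {z \<in> unit_disk. cmod (z - \<tau>) < M * (1 - cmod z)}"

text \<open>The angular derivative at a boundary fixed point \<open>\<tau>\<close>; existence of the angular limit of
  the quotient already forces \<open>f\<close> to have angular limit \<open>\<tau>\<close> at \<open>\<tau>\<close>.\<close>

definition has_angular_derivative_at_fixed_point ::
    "(complex \<Rightarrow> complex) \<Rightarrow> complex \<Rightarrow> complex \<Rightarrow> bool" where
  "has_angular_derivative_at_fixed_point f d \<tau> \<longleftrightarrow>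
     (\<forall>M>1. ((\<lambda>z. (f z - \<tau>) / (z - \<tau>)) \<longlongrightarrow> d) (at \<tau> within stolz_angle \<tau> M))"

definition hyperbolic_semigroup :: "(real \<Rightarrow> complex \<Rightarrow> complex) \<Rightarrow> bool" where
  "hyperbolic_semigroup \<phi> \<longleftrightarrow> holo_semigroup \<phi> \<and>
     (\<exists>\<tau>. denjoy_wolff_point \<phi> \<tau> \<and>
        (\<exists>d::real. 0 < d \<and> d < 1 \<and>
           has_angular_derivative_at_fixed_point (\<phi> 1) (of_real d) \<tau>))"

definition koenigs_function ::
    "(real \<Rightarrow> complex \<Rightarrow> complex) \<Rightarrow> (complex \<Rightarrow> complex) \<Rightarrow> bool" where
  "koenigs_function \<phi> h \<longleftrightarrow>
     h holomorphic_on unit_disk \<and> inj_on h unit_disk \<and>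
     (\<forall>t\<ge>0. \<forall>z\<in>unit_disk. h (\<phi> t z) = h z + of_real t)"

definition defining_function ::
    "complex set \<Rightarrow> real set \<Rightarrow> (real \<Rightarrow> ereal) \<Rightarrow> bool" where
  "defining_function \<Omega> I \<psi> \<longleftrightarrow>
     (\<forall>y\<in>I. \<psi> y < \<infinity>) \<and>
     (\<forall>c. openin (top_of_set I) {y \<in> I. \<psi> y < c}) \<and>
     \<Omega> = {Complex x y | x y. y \<in> I \<and> \<psi> y < ereal x}"


section \<open>The Dirichlet space and the generator of a semigroup of operators on it\<close>

definition dirichlet_space :: "(complex \<Rightarrow> complex) set" where
  "dirichlet_space = {f. f holomorphic_on unit_disk \<and>
     set_integrable lborel unit_disk (\<lambda>z. (cmod (deriv f z))\<^sup>2)}"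

definition dirichlet_norm :: "(complex \<Rightarrow> complex) \<Rightarrow> real" where
  "dirichlet_norm f = sqrt ((cmod (f 0))\<^sup>2 +
     1 / pi * set_lebesgue_integral lborel unit_disk (\<lambda>z. (cmod (deriv f z))\<^sup>2))"

text \<open>Membership in the space is part of convergence because \<^const>\<open>dirichlet_norm\<close> takes
  a junk value when the Dirichlet integral diverges.\<close>

definition dirichlet_tendsto ::
    "('i \<Rightarrow> complex \<Rightarrow> complex) \<Rightarrow> (complex \<Rightarrow> complex) \<Rightarrow> 'i filter \<Rightarrow> bool" where
  "dirichlet_tendsto F g net \<longleftrightarrow>
     g \<in> dirichlet_space \<and> (\<forall>\<^sub>F i in net. F i \<in> dirichlet_space) \<and>
     ((\<lambda>i. dirichlet_norm (\<lambda>z. F i z - g z)) \<longlongrightarrow> 0) net"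

definition composition_semigroup ::
    "(real \<Rightarrow> complex \<Rightarrow> complex) \<Rightarrow> real \<Rightarrow> (complex \<Rightarrow> complex) \<Rightarrow> (complex \<Rightarrow> complex)" where
  "composition_semigroup \<phi> t f = f \<circ> \<phi> t"

text \<open>The generator as a relation: \<open>f\<close> lies in its domain and is mapped to \<open>g\<close>.
  The value \<open>g\<close> is determined on the unit disk only.\<close>

definition dirichlet_generator ::
    "(real \<Rightarrow> (complex \<Rightarrow> complex) \<Rightarrow> (complex \<Rightarrow> complex)) \<Rightarrow>
     (complex \<Rightarrow> complex) \<Rightarrow> (complex \<Rightarrow> complex) \<Rightarrow> bool" where
  "dirichlet_generator T f g \<longleftrightarrow> f \<in> dirichlet_space \<and>
     dirichlet_tendsto (\<lambda>t z. (T t f z - f z) / of_real t) g (at_right 0)"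

definition dirichlet_point_spectrum ::
    "(real \<Rightarrow> (complex \<Rightarrow> complex) \<Rightarrow> (complex \<Rightarrow> complex)) \<Rightarrow> complex set" where
  "dirichlet_point_spectrum T =
     {\<mu>. \<exists>f. (\<exists>z\<in>unit_disk. f z \<noteq> 0) \<and> dirichlet_generator T f (\<lambda>z. \<mu> * f z)}"


section \<open>The exponential integral of the defining function\<close>

definition exp_ereal :: "ereal \<Rightarrow> ennreal" where
  "exp_ereal u =
     (if u = \<infinity> then \<infinity> else if u = -\<infinity> then 0 else ennreal (exp (real_of_ereal u)))"

text \<open>In \<open>ereal\<close> multiplication \<open>0 * (-\<infinity>) = 0\<close>, so the integrand is \<open>1\<close> for \<open>c = 0\<close>
  even where \<open>\<psi>\<close> is \<open>-\<infinity>\<close>.\<close>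

definition exp_integral :: "real \<Rightarrow> real \<Rightarrow> (real \<Rightarrow> ereal) \<Rightarrow> real \<Rightarrow> ennreal" where
  "exp_integral a b \<psi> c = (\<integral>\<^sup>+ y\<in>{a<..<b}. exp_ereal (ereal (2 * c) * \<psi> y) \<partial>lborel)"

definition critical_exponent :: "real \<Rightarrow> real \<Rightarrow> (real \<Rightarrow> ereal) \<Rightarrow> ereal" where
  "critical_exponent a b \<psi> = (INF c\<in>{c. c \<le> 0 \<and> exp_integral a b \<psi> c < \<infinity>}. ereal c)"

end

theory Submission
  imports Defs
begin

text \<open>
  The Koenigs function \<open>h\<close> conjugates the semigroup to the translations \<open>w \<mapsto> w + t\<close> of the domain
  \<open>\<Omega>\<close>, and on \<open>\<Omega>\<close> the generator is therefore differentiation. An eigenfunction for \<open>\<mu>\<close> solves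
  \<open>F' = \<mu> F\<close> and so is a multiple of \<open>exp (\<mu> * h z)\<close> (\<open>generator_eigenfunction_eq_exp\<close>). The only
  analytic point in this direction is to pass from convergence in the Dirichlet norm to a pointwise
  equation, which Fatou's lemma does. Conversely such an exponential is an eigenfunction as soon as it
  belongs to the Dirichlet space, because the semigroup only multiplies it by scalars
  (\<open>exp_eigenfunction_of_generator\<close>).

  It remains to decide when \<open>exp (\<mu> * h z)\<close> has a finite Dirichlet integral. For \<open>\<mu> \<noteq> 0\<close>, conformal
  invariance (\<open>set_integrable_conformal_image_iff\<close>) moves the integral to \<open>\<Omega>\<close>, where, up to bounded
  factors, the integrand is \<open>exp (2 * Re \<mu> * Re w)\<close>; here it is essential that \<open>\<Omega>\<close> lies in a
  horizontal strip (\<open>exp_mult_mem_dirichlet_space_iff\<close>). Integrating along the half-lines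
  \<open>x > \<psi> y\<close> gives infinity when \<open>Re \<mu> \<ge> 0\<close>, and \<open>exp (2 * Re \<mu> * \<psi> y) / (- 2 * Re \<mu>)\<close> otherwise, so
  that the integral over \<open>y\<close> is the exponential integral of \<open>\<psi>\<close> (\<open>domain_integral_finite_iff\<close>).

  For \<open>\<mu> = 0\<close> the constants are eigenfunctions. Finiteness of the exponential integral is inherited by
  larger negative exponents (\<open>exp_integral_finite_mono\<close>), hence the admissible nonpositive exponents
  form an interval with left end point the critical exponent and right end point 0, and the description of the spectrum by vertical
  strips follows.
\<close>

section \<open>Area integrals over plane domains\<close>

text \<open>
  A linear map that permutes the standard basis vectors carries boxes to boxes with the same side
  lengths. Two instances are needed: \<open>real \<times> real\<close> for Tonelli's theorem and \<open>real ^ 2\<close> for the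
  substitution rule, each identified with the complex plane.
\<close>

lemma distr_lborel_basis_bijection:
  fixes L :: "'a::euclidean_space \<Rightarrow> 'b::euclidean_space"
  assumes lin: "linear L" and bij: "bij_betw L Basis Basis"
  shows "distr lborel borel L = lborel"
proof (rule lborel_eqI[symmetric])
  have inner: "L x \<bullet> L b = x \<bullet> b" if "b \<in> Basis" for x b
  proof -
    have "L x = (\<Sum>i\<in>Basis. (x \<bullet> i) *\<^sub>R L i)"
      by (subst euclidean_representation[of x, symmetric]) (simp only: linear_sum[OF lin] linear_scale[OF lin])
    then have "L x \<bullet> L b = (\<Sum>i\<in>Basis. (x \<bullet> i) * (L i \<bullet> L b))"
      by (simp add: inner_sum_left)
    also have "\<dots> = (\<Sum>i\<in>Basis. if i = b then x \<bullet> i else 0)"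
    proof (intro sum.cong refl)
      fix i :: 'a assume i: "i \<in> Basis"
      have "L i \<in> Basis" "L b \<in> Basis" "L i = L b \<longleftrightarrow> i = b"
        using bij i that by (auto simp: bij_betw_def inj_on_eq_iff)
      then show "(x \<bullet> i) * (L i \<bullet> L b) = (if i = b then x \<bullet> i else 0)"
        by (simp add: inner_Basis)
    qed
    finally show ?thesis
      using that by simp
  qed
  have Lm: "L \<in> borel_measurable borel"
    using lin by (intro borel_measurable_continuous_onI linear_continuous_on linear_conv_bounded_linear[THEN iffD1])
  fix l u :: 'b
  assume le: "\<And>b. b \<in> Basis \<Longrightarrow> l \<bullet> b \<le> u \<bullet> b"
  define pull where "pull v = (\<Sum>b\<in>Basis. (v \<bullet> L b) *\<^sub>R b)" for v :: 'b
  have pull: "pull v \<bullet> b = v \<bullet> L b" if "b \<in> Basis" for v b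
    using that by (simp add: pull_def)
  have Basis: "Basis = L ` Basis"
    using bij by (simp add: bij_betw_def)
  have "L -` box l u = box (pull l) (pull u)"
    by (subst (1) set_eq_iff, simp add: mem_box Basis pull inner)
  moreover have "pull l \<bullet> b \<le> pull u \<bullet> b" if "b \<in> Basis" for b
    using le[of "L b"] that bij by (auto simp: pull bij_betw_def)
  ultimately have "emeasure (distr lborel borel L) (box l u) = (\<Prod>b\<in>Basis. (pull u - pull l) \<bullet> b)"
    using Lm by (simp add: emeasure_distr)
  also have "(\<Prod>b\<in>Basis. (pull u - pull l) \<bullet> b) = (\<Prod>b\<in>Basis. (u - l) \<bullet> L b)"
    by (intro prod.cong refl) (simp add: inner_diff_left pull)
  also have "\<dots> = (\<Prod>b\<in>Basis. (u - l) \<bullet> b)"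
    by (rule prod.reindex_bij_betw[OF bij])
  finally show "emeasure (distr lborel borel L) (box l u) = (\<Prod>b\<in>Basis. (u - l) \<bullet> b)" .
qed simp

text \<open>
  The outer variable is the imaginary part: a Koenigs domain is a union of horizontal half-lines,
  one for each height.
\<close>

lemma nn_integral_lborel_complex:
  assumes [measurable]: "G \<in> borel_measurable borel"
  shows "(\<integral>\<^sup>+ w. G w \<partial>lborel) = (\<integral>\<^sup>+ y. \<integral>\<^sup>+ x. G (Complex x y) \<partial>lborel \<partial>lborel)"
proof -
  define L where "L = (\<lambda>(y, x). Complex x y)"
  have L: "L = (\<lambda>p. of_real (snd p) + \<i> * of_real (fst p))"
    by (auto simp: L_def Complex_eq fun_eq_iff)
  have [measurable]: "L \<in> borel_measurable borel"
    unfolding L by (intro borel_measurable_continuous_onI continuous_intros)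
  have "linear L"
    by (rule linearI) (auto simp: L algebra_simps scaleR_conv_of_real)
  moreover have "bij_betw L Basis Basis"
    by (auto simp: bij_betw_def inj_on_def L Basis_prod_def Basis_complex_def)
  ultimately have "(\<integral>\<^sup>+ w. G w \<partial>lborel) = (\<integral>\<^sup>+ w. G w \<partial>distr lborel borel L)"
    by (simp add: distr_lborel_basis_bijection)
  also have "\<dots> = (\<integral>\<^sup>+ p. G (L p) \<partial>(lborel \<Otimes>\<^sub>M lborel))"
    by (subst nn_integral_distr) (auto simp: lborel_prod)
  also have "\<dots> = (\<integral>\<^sup>+ y. \<integral>\<^sup>+ x. G (L (y, x)) \<partial>lborel \<partial>lborel)"
    by (rule lborel.nn_integral_fst[symmetric]) (simp add: lborel_prod)
  finally show ?thesis
    by (simp add: L_def)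
qed

text \<open>
  The substitution rule for integrals in several variables speaks of \<open>real ^ 'n\<close>; the next two maps
  are mutually inverse linear isometries that transport it to the complex plane.
\<close>

definition plane_to_complex :: "real ^ 2 \<Rightarrow> complex" where
  "plane_to_complex v = Complex (v $ 1) (v $ 2)"

definition complex_to_plane :: "complex \<Rightarrow> real ^ 2" where
  "complex_to_plane z = (\<chi> i. if i = 1 then Re z else Im z)"

lemma plane_to_complex_inverse [simp]:
  "plane_to_complex (complex_to_plane z) = z" "complex_to_plane (plane_to_complex v) = v"
  by (auto simp: plane_to_complex_def complex_to_plane_def vec_eq_iff forall_2)

lemma bounded_linear_plane_to_complex: "bounded_linear plane_to_complex"
  unfolding linear_conv_bounded_linear[symmetric]
  by (rule linearI) (auto simp: plane_to_complex_def complex_eq_iff)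

lemma bounded_linear_complex_to_plane: "bounded_linear complex_to_plane"
  unfolding linear_conv_bounded_linear[symmetric]
  by (rule linearI) (auto simp: complex_to_plane_def vec_eq_iff)

lemma distr_lborel_plane_to_complex: "distr lborel borel plane_to_complex = lborel"
proof (rule distr_lborel_basis_bijection)
  show "linear plane_to_complex"
    using bounded_linear_plane_to_complex by (rule bounded_linear.linear)
  have "plane_to_complex (axis 1 1) = 1" "plane_to_complex (axis 2 1) = \<i>"
    by (auto simp: plane_to_complex_def axis_def complex_eq_iff)
  then have "bij_betw plane_to_complex {axis 1 1, axis 2 1} {1, \<i>}"
    by (auto simp: bij_betw_def inj_on_def)
  moreover have "Basis = {axis 1 1, axis 2 1 :: real ^ 2}"
    by (auto simp: Basis_vec_def UNIV_2)
  ultimately show "bij_betw plane_to_complex Basis Basis"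
    by (simp add: Basis_complex_def)
qed

text \<open>
  This is the Jacobian of a holomorphic map: multiplication by \<open>x + i y\<close> has the matrix with rows
  \<open>(x, -y)\<close> and \<open>(y, x)\<close>.
\<close>

lemma det_complex_multiplication:
  "det (matrix (\<lambda>v. complex_to_plane (c * plane_to_complex v))) = (cmod c)\<^sup>2"
proof -
  have "plane_to_complex (axis 1 1) = 1" "plane_to_complex (axis 2 1) = \<i>"
    by (auto simp: plane_to_complex_def axis_def complex_eq_iff)
  then show ?thesis
    by (simp add: det_2 matrix_def complex_to_plane_def cmod_power2 flip: power2_eq_square)
qed

text \<open>
  The values lie in \<open>real ^ 1\<close> because the substitution rule is stated for vector-valued integrands.
  Continuity on an open set makes the integrand Borel measurable, so that integrability with respect
  to Lebesgue measure and to its Borel part agree.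
\<close>

lemma plane_absolutely_integrable_iff:
  fixes G :: "complex \<Rightarrow> real"
  assumes "open A" and "continuous_on A G"
  shows "(\<lambda>v. vec (G (plane_to_complex v)) :: real ^ 1) absolutely_integrable_on (plane_to_complex -` A)
     \<longleftrightarrow> set_integrable lborel A G"
proof -
  have [measurable]: "plane_to_complex \<in> borel_measurable borel"
    by (intro borel_measurable_continuous_onI linear_continuous_on bounded_linear_plane_to_complex)
  have G: "(\<lambda>z. indicator A z *\<^sub>R G z) \<in> borel_measurable borel"
    using assms by (intro borel_measurable_continuous_on_indicator) auto
  have "(\<lambda>v. vec (G (plane_to_complex v)) :: real ^ 1) absolutely_integrable_on (plane_to_complex -` A)
     \<longleftrightarrow> (\<lambda>v. G (plane_to_complex v)) absolutely_integrable_on (plane_to_complex -` A)"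
    by (simp add: absolutely_integrable_on_1_iff)
  also have "\<dots> \<longleftrightarrow> integrable lebesgue (\<lambda>v. indicator A (plane_to_complex v) *\<^sub>R G (plane_to_complex v))"
    by (simp add: set_integrable_def indicator_vimage)
  also have "\<dots> \<longleftrightarrow> integrable lborel (\<lambda>v. indicator A (plane_to_complex v) *\<^sub>R G (plane_to_complex v))"
    using measurable_compose[OF _ G, of plane_to_complex] by (intro integrable_completion) auto
  also have "\<dots> \<longleftrightarrow> integrable (distr lborel borel plane_to_complex) (\<lambda>z. indicator A z *\<^sub>R G z)"
    using G by (intro integrable_distr_eq[symmetric]) auto
  finally show ?thesis
    by (simp add: distr_lborel_plane_to_complex set_integrable_def)
qed

text \<open>
  Conformal invariance: the derivative of \<open>h\<close> at \<open>z\<close> is multiplication by \<open>deriv h z\<close>, with Jacobian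
  \<open>(cmod (deriv h z))\<^sup>2\<close>, which is the factor that the chain rule produces in a Dirichlet integral.
\<close>

lemma set_integrable_conformal_image_iff:
  fixes G :: "complex \<Rightarrow> real"
  assumes S: "open S" and h: "h holomorphic_on S" "inj_on h S" and G: "continuous_on (h ` S) G"
  shows "set_integrable lborel S (\<lambda>z. (cmod (deriv h z))\<^sup>2 * G (h z))
     \<longleftrightarrow> set_integrable lborel (h ` S) G"
proof -
  let ?L = plane_to_complex and ?J = complex_to_plane
  define g where "g v = ?J (h (?L v))" for v
  define g' where "g' v u = ?J (deriv h (?L v) * ?L u)" for v u
  have "open (?L -` S)"
    using S by (intro open_vimage linear_continuous_on bounded_linear_plane_to_complex)
  then have leb: "?L -` S \<in> sets lebesgue"
    by auto
  have der: "(g has_derivative g' v) (at v within ?L -` S)" if "v \<in> ?L -` S" for v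
  proof -
    have "(h has_derivative (*) (deriv h (?L v))) (at (?L v))"
      using that S h(1) holomorphic_derivI[of h S "?L v"] by (auto simp: has_field_derivative_def)
    then have "((\<lambda>v. h (?L v)) has_derivative (\<lambda>u. deriv h (?L v) * ?L u)) (at v within ?L -` S)"
      by (rule has_derivative_compose[rotated])
         (intro bounded_linear_imp_has_derivative bounded_linear_plane_to_complex)
    then show ?thesis
      unfolding g_def g'_def
      by (rule bounded_linear.has_derivative[OF bounded_linear_complex_to_plane])
  qed
  have inj: "inj_on g (?L -` S)"
    using h(2) unfolding inj_on_def g_def by (metis plane_to_complex_inverse vimageE)
  have img: "g ` (?L -` S) = ?L -` (h ` S)"
  proof (intro set_eqI iffI)
    fix v assume "v \<in> ?L -` (h ` S)"
    then obtain z where "z \<in> S" "?L v = h z" by auto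
    then have "v = g (?J z)" "?J z \<in> ?L -` S"
      by (auto simp: g_def dest: arg_cong[of _ _ ?J])
    then show "v \<in> g ` (?L -` S)" by blast
  qed (auto simp: g_def)
  have "set_integrable lborel (h ` S) G
     \<longleftrightarrow> (\<lambda>v. vec (G (?L v)) :: real ^ 1) absolutely_integrable_on (g ` (?L -` S))"
    unfolding img using h S G by (intro plane_absolutely_integrable_iff[symmetric] open_mapping_thm3)
  also have "\<dots> \<longleftrightarrow> (\<lambda>v. \<bar>det (matrix (g' v))\<bar> *\<^sub>R (vec (G (?L (g v))) :: real ^ 1))
      absolutely_integrable_on (?L -` S)"
    by (rule absolutely_integrable_change_of_variables[OF leb der inj])
  also have "\<dots> \<longleftrightarrow> (\<lambda>v. vec ((cmod (deriv h (?L v)))\<^sup>2 * G (h (?L v))) :: real ^ 1)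
      absolutely_integrable_on (?L -` S)"
    unfolding g'_def det_complex_multiplication
    by (intro arg_cong2[of _ _ _ _ "(absolutely_integrable_on)"] ext) (auto simp: g_def vec_eq_iff)
  also have "\<dots> \<longleftrightarrow> set_integrable lborel S (\<lambda>z. (cmod (deriv h z))\<^sup>2 * G (h z))"
    using h S by (intro plane_absolutely_integrable_iff continuous_intros
        holomorphic_on_imp_continuous_on holomorphic_deriv
        continuous_on_compose2[OF G]) auto
  finally show ?thesis by simp
qed

section \<open>The exponential integral as an area integral\<close>

lemma nn_integral_top_if_ge_1_on_long_intervals:
  fixes f :: "real \<Rightarrow> ennreal"
  assumes long: "\<And>n::nat. \<exists>p. \<forall>x\<in>{p..p + real n}. 1 \<le> f x"
  shows "(\<integral>\<^sup>+ x. f x \<partial>lborel) = \<infinity>"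
proof (rule ccontr)
  assume "(\<integral>\<^sup>+ x. f x \<partial>lborel) \<noteq> \<infinity>"
  then obtain n :: nat where n: "(\<integral>\<^sup>+ x. f x \<partial>lborel) < of_nat n"
    using ennreal_Ex_less_of_nat by (auto simp: top.not_eq_extremum)
  obtain p where p: "\<forall>x\<in>{p..p + real n}. 1 \<le> f x"
    using long by blast
  have "of_nat n = (\<integral>\<^sup>+ x. indicator {p..p + real n} x \<partial>lborel)"
    by (simp add: ennreal_of_nat_eq_real_of_nat)
  also have "\<dots> \<le> (\<integral>\<^sup>+ x. f x \<partial>lborel)"
    using p by (intro nn_integral_mono) (auto simp: indicator_def)
  finally show False
    using n by simp
qed

text \<open>
  This is \<open>\<integral>\<^sub>u\<^sup>\<infinity> e\<^sup>2\<^sup>c\<^sup>x dx = e\<^sup>2\<^sup>c\<^sup>u / (- 2 c)\<close> with the factor cleared. It includes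
  \<open>u = -\<infinity>\<close>, where both sides are infinite.
\<close>

lemma nn_integral_exp_ray_neg:
  fixes c :: real and u :: ereal
  assumes "c < 0" and "u < \<infinity>"
  shows "ennreal (- 2 * c) * (\<integral>\<^sup>+ x. ennreal (exp (2 * c * x)) * indicator {x. u < ereal x} x \<partial>lborel)
       = exp_ereal (ereal (2 * c) * u)"
proof (cases u)
  case (real r)
  have "(\<integral>\<^sup>+ x. ennreal (exp (2 * c * x)) * indicator {x. u < ereal x} x \<partial>lborel)
      = (\<integral>\<^sup>+ x. ennreal (exp (2 * c * x)) * indicator {r..} x \<partial>lborel)"
    using AE_lborel_singleton[of r] by (intro nn_integral_cong_AE) (auto simp: real indicator_def elim: eventually_mono)
  also have "\<dots> = ennreal (exp (2 * c * r) / (- 2 * c))"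
    using has_integral_exp_minus_to_infinity[of "- 2 * c" r] assms(1)
    by (intro nn_integral_has_integral_lebesgue') auto
  finally have "ennreal (- 2 * c) * (\<integral>\<^sup>+ x. ennreal (exp (2 * c * x)) * indicator {x. u < ereal x} x \<partial>lborel)
      = ennreal ((- 2 * c) * (exp (2 * c * r) / (- 2 * c)))"
    using assms(1) by (simp only:) (rule ennreal_mult[symmetric]; simp add: divide_nonneg_neg divide_nonneg_pos)
  then show ?thesis
    using assms(1) by (simp add: real exp_ereal_def)
next
  case MInf
  have "(\<integral>\<^sup>+ x. ennreal (exp (2 * c * x)) * indicator {x. u < ereal x} x \<partial>lborel) = \<infinity>"
  proof (rule nn_integral_top_if_ge_1_on_long_intervals)
    fix n :: nat
    show "\<exists>p. \<forall>x\<in>{p..p + real n}. 1 \<le> ennreal (exp (2 * c * x)) * indicator {x. u < ereal x} x"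
      using assms(1) by (intro exI[of _ "- real n"]) (auto simp: MInf mult_nonpos_nonpos)
  qed
  with MInf assms(1) show ?thesis
    by (simp add: exp_ereal_def ennreal_mult_top)
qed (use assms in auto)

text \<open>
  The integrand is at least 1 on the positive part of the ray. Applied to every height of the domain,
  this excludes all eigenvalues other than 0 in the closed right half-plane.
\<close>

lemma nn_integral_exp_ray_nonneg:
  fixes c :: real and u :: ereal
  assumes "0 \<le> c" and "u < \<infinity>"
  shows "(\<integral>\<^sup>+ x. ennreal (exp (2 * c * x)) * indicator {x. u < ereal x} x \<partial>lborel) = \<infinity>"
proof (rule nn_integral_top_if_ge_1_on_long_intervals)
  fix n :: nat
  obtain r where r: "0 \<le> r" "u < ereal r"
    using assms(2) by (cases u) (auto intro: that[of 0] that[of "\<bar>real_of_ereal u\<bar> + 1"])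
  have "1 \<le> ennreal (exp (2 * c * x)) * indicator {x. u < ereal x} x" if "x \<in> {r..r + real n}" for x
  proof -
    have "u < ereal x" using r(2) that by (auto intro: less_le_trans)
    then show ?thesis using r(1) assms(1) that by simp
  qed
  then show "\<exists>p. \<forall>x\<in>{p..p + real n}. 1 \<le> ennreal (exp (2 * c * x)) * indicator {x. u < ereal x} x"
    by blast
qed

context
  fixes a b :: real and \<psi> :: "real \<Rightarrow> ereal" and \<Omega> :: "complex set"
  assumes def\<psi>: "defining_function \<Omega> {a<..<b} \<psi>" and \<Omega>: "open \<Omega>"
begin

text \<open>
  Throughout this block \<open>\<Omega>\<close> is the open region to the right of the graph of \<open>\<psi>\<close>. Integrating
  first along horizontal lines turns the area integral of \<open>exp (2 * c * Re w)\<close> into the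
  one-dimensional exponential integral of \<open>\<psi>\<close>.
\<close>

lemma indicator_domain_slice:
  "indicator \<Omega> (Complex x y) = (indicator {a<..<b} y * indicator {x. \<psi> y < ereal x} x :: ennreal)"
  using def\<psi> by (auto simp: defining_function_def indicator_def)

text \<open>
  Openness of \<open>\<Omega>\<close> gives this measurability through Tonelli's theorem. By the next lemma, it is
  also how measurability of the exponential of \<open>\<psi>\<close> is obtained.
\<close>

lemma borel_measurable_slice_integral:
  "(\<lambda>y. \<integral>\<^sup>+ x. ennreal (exp (2 * c * x)) * indicator \<Omega> (Complex x y) \<partial>lborel) \<in> borel_measurable borel"
proof -
  have [measurable]: "\<Omega> \<in> sets borel"
    using \<Omega> by simp
  have [measurable]: "(\<lambda>p. Complex (snd p) (fst p)) \<in> borel \<Otimes>\<^sub>M borel \<rightarrow>\<^sub>M borel"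
    unfolding Complex_eq borel_prod by (intro borel_measurable_continuous_onI continuous_intros)
  show ?thesis
    by measurable
qed

lemma slice_integral_neg:
  assumes "c < 0"
  shows "ennreal (- 2 * c) * (\<integral>\<^sup>+ x. ennreal (exp (2 * c * x)) * indicator \<Omega> (Complex x y) \<partial>lborel)
       = exp_ereal (ereal (2 * c) * \<psi> y) * indicator {a<..<b} y"
proof (cases "y \<in> {a<..<b}")
  case True
  then have "\<psi> y < \<infinity>"
    using def\<psi> by (auto simp: defining_function_def)
  with True assms show ?thesis
    using nn_integral_exp_ray_neg[OF assms, of "\<psi> y"] by (simp add: indicator_domain_slice)
qed (simp add: indicator_domain_slice)

lemma domain_integral_eq_iterated:
  "(\<integral>\<^sup>+ w. ennreal (exp (2 * c * Re w)) * indicator \<Omega> w \<partial>lborel)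
   = (\<integral>\<^sup>+ y. \<integral>\<^sup>+ x. ennreal (exp (2 * c * x)) * indicator \<Omega> (Complex x y) \<partial>lborel \<partial>lborel)"
proof -
  have "\<Omega> \<in> sets borel"
    using \<Omega> by simp
  then show ?thesis
    by (subst nn_integral_lborel_complex) auto
qed

lemma domain_integral_neg:
  assumes "c < 0"
  shows "ennreal (- 2 * c) * (\<integral>\<^sup>+ w. ennreal (exp (2 * c * Re w)) * indicator \<Omega> w \<partial>lborel)
       = exp_integral a b \<psi> c"
  unfolding domain_integral_eq_iterated exp_integral_def slice_integral_neg[OF assms, symmetric]
  by (rule nn_integral_cmult[symmetric]) (simp add: borel_measurable_slice_integral)

text \<open>
  Every horizontal line of height between \<open>a\<close> and \<open>b\<close> contributes an infinite integral, and these
  heights form a set of positive measure.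
\<close>

lemma domain_integral_nonneg:
  assumes "0 \<le> c" and "a < b"
  shows "(\<integral>\<^sup>+ w. ennreal (exp (2 * c * Re w)) * indicator \<Omega> w \<partial>lborel) = \<infinity>"
proof -
  have slice: "(\<integral>\<^sup>+ x. ennreal (exp (2 * c * x)) * indicator \<Omega> (Complex x y) \<partial>lborel) = \<infinity> * indicator {a<..<b} y" for y
  proof (cases "y \<in> {a<..<b}")
    case True
    then have "\<psi> y < \<infinity>"
      using def\<psi> by (auto simp: defining_function_def)
    with True show ?thesis
      using nn_integral_exp_ray_nonneg[OF assms(1), of "\<psi> y"] by (simp add: indicator_domain_slice)
  qed (simp add: indicator_domain_slice)
  show ?thesis
    unfolding domain_integral_eq_iterated slice
    using assms(2) by (subst nn_integral_cmult_indicator) (auto simp: ennreal_top_mult)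
qed

lemma domain_integral_finite_iff:
  assumes "a < b"
  shows "(\<integral>\<^sup>+ w. ennreal (exp (2 * c * Re w)) * indicator \<Omega> w \<partial>lborel) < \<infinity>
     \<longleftrightarrow> c < 0 \<and> exp_integral a b \<psi> c < \<infinity>"
proof (cases "c < 0")
  case True
  then show ?thesis
    by (auto simp: ennreal_mult_less_top ennreal_eq_0_iff simp flip: domain_integral_neg)
qed (use assms domain_integral_nonneg[of c] in auto)

text \<open>
  Where \<open>\<psi>\<close> is nonnegative the larger exponential is at most 1, and where it is negative the
  exponential decreases in the exponent; since the interval of heights is bounded, the constant 1 is
  integrable. The admissible negative exponents therefore form an interval, which is why the
  spectrum is described by vertical strips.
\<close>

lemma exp_integral_finite_mono:
  assumes "c \<le> c'" "c' < 0" and fin: "exp_integral a b \<psi> c < \<infinity>"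
  shows "exp_integral a b \<psi> c' < \<infinity>"
proof -
  have [measurable]: "(\<lambda>y. exp_ereal (ereal (2 * c) * \<psi> y) * indicator {a<..<b} y) \<in> borel_measurable borel"
    using assms borel_measurable_slice_integral[of c] by (subst slice_integral_neg[symmetric]) auto
  have "exp_ereal (ereal (2 * c') * u) \<le> 1 + exp_ereal (ereal (2 * c) * u)" for u
  proof (cases u)
    case (real r)
    have "exp (2 * c' * r) \<le> 1 + exp (2 * c * r)"
    proof (cases "0 \<le> r")
      case True
      then have "2 * c' * r \<le> 0" using assms by (simp add: mult_nonpos_nonneg)
      then have "exp (2 * c' * r) \<le> 1" by simp
      also have "\<dots> \<le> 1 + exp (2 * c * r)" by simp
      finally show ?thesis .
    next
      case False
      then have "2 * c' * r \<le> 2 * c * r" using assms by (simp add: mult_right_mono_neg)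
      then have "exp (2 * c' * r) \<le> exp (2 * c * r)" by (simp only: exp_le_cancel_iff)
      then show ?thesis by linarith
    qed
    then show ?thesis
      using real by (simp add: exp_ereal_def ennreal_leI flip: ennreal_1 ennreal_plus)
  qed (use assms in \<open>auto simp: exp_ereal_def\<close>)
  then have "exp_integral a b \<psi> c'
     \<le> (\<integral>\<^sup>+ y. indicator {a<..<b} y + exp_ereal (ereal (2 * c) * \<psi> y) * indicator {a<..<b} y \<partial>lborel)"
    unfolding exp_integral_def by (intro nn_integral_mono) (auto simp: indicator_def)
  also have "\<dots> = emeasure lborel {a<..<b} + exp_integral a b \<psi> c"
    unfolding exp_integral_def by (subst nn_integral_add) auto
  also have "\<dots> < \<infinity>"
    using fin emeasure_lborel_box_finite[of a b] by simp
  finally show ?thesis .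
qed

end

section \<open>The Dirichlet space\<close>

lemma set_integrable_nonneg_iff:
  fixes f :: "'a::euclidean_space \<Rightarrow> real"
  assumes "open A" "continuous_on A f" "\<And>x. x \<in> A \<Longrightarrow> 0 \<le> f x"
  shows "set_integrable lborel A f \<longleftrightarrow> (\<integral>\<^sup>+ x. ennreal (f x) * indicator A x \<partial>lborel) < \<infinity>"
proof -
  have "(\<lambda>x. indicator A x *\<^sub>R f x) \<in> borel_measurable borel"
    using assms by (intro borel_measurable_continuous_on_indicator) auto
  moreover have "ennreal (norm (indicator A x *\<^sub>R f x)) = ennreal (f x) * indicator A x" for x
    using assms(3) by (auto simp: indicator_def)
  ultimately show ?thesis
    unfolding set_integrable_def integrable_iff_bounded by simp
qed

lemma set_integrable_continuous_dominated:
  fixes f g :: "'a::euclidean_space \<Rightarrow> real"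
  assumes "set_integrable lborel A g" "open A" "continuous_on A f"
    and "\<And>x. x \<in> A \<Longrightarrow> \<bar>f x\<bar> \<le> g x"
  shows "set_integrable lborel A f"
  unfolding set_integrable_def
proof (rule Bochner_Integration.integrable_bound)
  show "integrable lborel (\<lambda>x. indicator A x *\<^sub>R g x)"
    using assms(1) by (simp add: set_integrable_def)
  have "(\<lambda>x. indicator A x *\<^sub>R f x) \<in> borel_measurable borel"
    using assms by (intro borel_measurable_continuous_on_indicator) auto
  then show "(\<lambda>x. indicator A x *\<^sub>R f x) \<in> borel_measurable lborel"
    by simp
  show "AE x in lborel. norm (indicator A x *\<^sub>R f x) \<le> norm (indicator A x *\<^sub>R g x)"
    using assms(4) by (intro AE_I2) (force simp: indicator_def)
qed

lemma continuous_on_cmod_deriv_power2: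
  "f holomorphic_on S \<Longrightarrow> open S \<Longrightarrow> continuous_on S (\<lambda>z. (cmod (deriv f z))\<^sup>2)"
  by (intro continuous_intros holomorphic_on_imp_continuous_on holomorphic_deriv)

lemma deriv_eq_on_open:
  assumes "open S" "z \<in> S" "\<And>w. w \<in> S \<Longrightarrow> f w = g w"
  shows "deriv f z = deriv g z"
  using assms by (intro deriv_cong_ev refl) (auto simp: eventually_nhds)

lemma dirichlet_cong:
  assumes "\<And>z. z \<in> unit_disk \<Longrightarrow> f z = g z"
  shows "f \<in> dirichlet_space \<longleftrightarrow> g \<in> dirichlet_space" and "dirichlet_norm f = dirichlet_norm g"
proof -
  have d: "deriv f z = deriv g z" if "z \<in> unit_disk" for z
    using that assms by (intro deriv_eq_on_open[of unit_disk]) auto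
  show "f \<in> dirichlet_space \<longleftrightarrow> g \<in> dirichlet_space"
    unfolding dirichlet_space_def mem_Collect_eq using assms d
    by (intro arg_cong2[of _ _ _ _ "(\<and>)"] holomorphic_cong set_integrable_cong refl) auto
  have "(LINT z:unit_disk|lborel. (cmod (deriv f z))\<^sup>2) = (LINT z:unit_disk|lborel. (cmod (deriv g z))\<^sup>2)"
    by (rule set_lebesgue_integral_cong) (auto simp: d)
  then show "dirichlet_norm f = dirichlet_norm g"
    using assms by (simp add: dirichlet_norm_def)
qed

lemma deriv_cmult_holomorphic:
  "f holomorphic_on S \<Longrightarrow> open S \<Longrightarrow> z \<in> S \<Longrightarrow> deriv (\<lambda>z. c * f z) z = c * deriv f z"
  by (rule deriv_cmult) (rule holomorphic_on_imp_differentiable_at)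

lemma dirichlet_space_cmult:
  assumes "f \<in> dirichlet_space"
  shows "(\<lambda>z. c * f z) \<in> dirichlet_space"
proof -
  have f: "f holomorphic_on unit_disk"
    using assms by (simp add: dirichlet_space_def)
  have "set_integrable lborel unit_disk (\<lambda>z. (cmod (c * deriv f z))\<^sup>2)"
    using assms by (simp add: dirichlet_space_def norm_mult power_mult_distrib)
  then have "set_integrable lborel unit_disk (\<lambda>z. (cmod (deriv (\<lambda>z. c * f z) z))\<^sup>2)"
    using f by (subst set_integrable_cong[OF refl refl]) (auto simp: deriv_cmult_holomorphic[where S = unit_disk])
  then show ?thesis
    using f by (auto simp: dirichlet_space_def intro: holomorphic_intros)
qed

lemma dirichlet_norm_cmult:
  assumes "f \<in> dirichlet_space"
  shows "dirichlet_norm (\<lambda>z. c * f z) = cmod c * dirichlet_norm f"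
proof -
  have f: "f holomorphic_on unit_disk"
    using assms by (simp add: dirichlet_space_def)
  have "(LINT z:unit_disk|lborel. (cmod (deriv (\<lambda>z. c * f z) z))\<^sup>2)
      = (LINT z:unit_disk|lborel. (cmod c)\<^sup>2 * (cmod (deriv f z))\<^sup>2)"
    using f by (intro set_lebesgue_integral_cong)
      (auto simp: deriv_cmult_holomorphic[where S = unit_disk] norm_mult power_mult_distrib)
  also have "\<dots> = (cmod c)\<^sup>2 * (LINT z:unit_disk|lborel. (cmod (deriv f z))\<^sup>2)"
    by simp
  finally have "dirichlet_norm (\<lambda>z. c * f z)
      = sqrt ((cmod c)\<^sup>2 * ((cmod (f 0))\<^sup>2 + 1 / pi * (LINT z:unit_disk|lborel. (cmod (deriv f z))\<^sup>2)))"
    by (simp add: dirichlet_norm_def norm_mult power_mult_distrib distrib_left)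
  then show ?thesis
    by (simp add: dirichlet_norm_def real_sqrt_mult)
qed

lemma dirichlet_space_diff:
  assumes "f \<in> dirichlet_space" "g \<in> dirichlet_space"
  shows "(\<lambda>z. f z - g z) \<in> dirichlet_space"
proof -
  have hol: "f holomorphic_on unit_disk" "g holomorphic_on unit_disk"
    using assms by (auto simp: dirichlet_space_def)
  then have hol': "(\<lambda>z. f z - g z) holomorphic_on unit_disk"
    by (intro holomorphic_intros)
  have "set_integrable lborel unit_disk (\<lambda>z. 2 * (cmod (deriv f z))\<^sup>2 + 2 * (cmod (deriv g z))\<^sup>2)"
    using assms by (intro set_integral_add) (auto simp: dirichlet_space_def)
  then have "set_integrable lborel unit_disk (\<lambda>z. (cmod (deriv (\<lambda>z. f z - g z) z))\<^sup>2)"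
  proof (rule set_integrable_continuous_dominated)
    fix z :: complex assume z: "z \<in> unit_disk"
    have "deriv (\<lambda>z. f z - g z) z = deriv f z - deriv g z"
      using hol z by (intro deriv_diff holomorphic_on_imp_differentiable_at[where s = unit_disk]) auto
    then have "(cmod (deriv (\<lambda>z. f z - g z) z))\<^sup>2 \<le> (cmod (deriv f z) + cmod (deriv g z))\<^sup>2"
      by (simp add: norm_triangle_ineq4 power_mono)
    also have "\<dots> \<le> 2 * (cmod (deriv f z))\<^sup>2 + 2 * (cmod (deriv g z))\<^sup>2"
      using zero_le_power2[of "cmod (deriv f z) - cmod (deriv g z)"]
      by (simp add: power2_eq_square algebra_simps)
    finally show "\<bar>(cmod (deriv (\<lambda>z. f z - g z) z))\<^sup>2\<bar>
        \<le> 2 * (cmod (deriv f z))\<^sup>2 + 2 * (cmod (deriv g z))\<^sup>2"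
      by simp
  qed (use hol' continuous_on_cmod_deriv_power2 in auto)
  with hol' show ?thesis
    by (simp add: dirichlet_space_def)
qed

text \<open>
  Both terms of the squared norm are nonnegative, so each tends to 0. Membership in the Dirichlet
  space matters: it identifies the nonnegative integral with the Bochner integral in the norm.
\<close>

lemma dirichlet_norm_tendsto_0D:
  assumes "\<And>n. F n \<in> dirichlet_space" and "((\<lambda>n. dirichlet_norm (F n)) \<longlongrightarrow> 0) net"
  shows "((\<lambda>n. F n 0) \<longlongrightarrow> 0) net"
    and "((\<lambda>n. \<integral>\<^sup>+ z. ennreal ((cmod (deriv (F n) z))\<^sup>2) * indicator unit_disk z \<partial>lborel) \<longlongrightarrow> 0) net"
proof -
  define J where "J n = (LINT z:unit_disk|lborel. (cmod (deriv (F n) z))\<^sup>2)" for n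
  have J0: "0 \<le> J n" for n
    unfolding J_def set_lebesgue_integral_def by (intro Bochner_Integration.integral_nonneg) auto
  have sq: "(dirichlet_norm (F n))\<^sup>2 = (cmod (F n 0))\<^sup>2 + 1 / pi * J n" for n
    using J0[of n] by (simp add: dirichlet_norm_def J_def)
  have lim: "((\<lambda>n. (dirichlet_norm (F n))\<^sup>2) \<longlongrightarrow> 0) net"
    using tendsto_power[OF assms(2), of 2] by simp
  have "((\<lambda>n. (cmod (F n 0))\<^sup>2) \<longlongrightarrow> 0) net"
    by (rule tendsto_sandwich[OF _ _ tendsto_const lim]) (use J0 in \<open>auto simp: sq\<close>)
  then show "((\<lambda>n. F n 0) \<longlongrightarrow> 0) net"
    using tendsto_norm_zero_iff tendsto_real_sqrt by fastforce
  have "((\<lambda>n. 1 / pi * J n) \<longlongrightarrow> 0) net"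
    by (rule tendsto_sandwich[OF _ _ tendsto_const lim]) (use J0 in \<open>auto simp: sq\<close>)
  then have "((\<lambda>n. J n) \<longlongrightarrow> 0) net"
    using tendsto_mult_left[of _ 0 net pi] by force
  moreover have "(\<integral>\<^sup>+ z. ennreal ((cmod (deriv (F n) z))\<^sup>2) * indicator unit_disk z \<partial>lborel) = ennreal (J n)" for n
  proof -
    have "integrable lborel (\<lambda>z. indicator unit_disk z *\<^sub>R (cmod (deriv (F n) z))\<^sup>2)"
      using assms(1)[of n] by (simp add: dirichlet_space_def set_integrable_def)
    then have "(\<integral>\<^sup>+ z. ennreal (indicator unit_disk z *\<^sub>R (cmod (deriv (F n) z))\<^sup>2) \<partial>lborel) = ennreal (J n)"
      unfolding J_def set_lebesgue_integral_def by (rule nn_integral_eq_integral) auto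
    then show ?thesis
      by (simp add: ennreal_mult' ennreal_indicator mult.commute)
  qed
  ultimately show "((\<lambda>n. \<integral>\<^sup>+ z. ennreal ((cmod (deriv (F n) z))\<^sup>2) * indicator unit_disk z \<partial>lborel) \<longlongrightarrow> 0) net"
    using tendsto_ennrealI[of J 0 net] by simp
qed

lemma continuous_AE_zero_imp_zero:
  fixes k :: "'a::euclidean_space \<Rightarrow> 'b::t1_space"
  assumes S: "open S" "continuous_on S k" and "AE x in lborel. x \<in> S \<longrightarrow> k x = c" and "x \<in> S"
  shows "k x = c"
proof (rule ccontr)
  assume "k x \<noteq> c"
  define U where "U = S \<inter> k -` (- {c})"
  have "open U"
    unfolding U_def using S by (intro continuous_open_preimage) auto
  moreover have "x \<in> U"
    using \<open>k x \<noteq> c\<close> \<open>x \<in> S\<close> by (simp add: U_def)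
  moreover have "U \<in> null_sets lborel"
    using assms(3) \<open>open U\<close> by (subst AE_iff_null_sets) (auto simp: U_def elim: eventually_mono)
  then have "negligible U"
    by (simp add: negligible_iff_null_sets null_sets_completionI)
  ultimately show False
    using open_not_negligible by blast
qed

section \<open>Exponentials of the Koenigs function\<close>

text \<open>
  By conformal invariance the Dirichlet integral is that of \<open>exp (\<mu> * w)\<close> over the image domain,
  whose density is a multiple of \<open>exp (2 * Re \<mu> * Re w - 2 * Im \<mu> * Im w)\<close>. In a horizontal strip
  the contribution of \<open>Im \<mu>\<close> is bounded above and away from 0, so only \<open>Re \<mu>\<close> decides.
\<close>

lemma exp_mult_mem_dirichlet_space_iff:
  assumes h: "h holomorphic_on unit_disk" "inj_on h unit_disk"
    and strip: "\<And>w. w \<in> h ` unit_disk \<Longrightarrow> \<bar>Im w\<bar> \<le> B" and "\<mu> \<noteq> 0"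
  shows "(\<lambda>z. exp (\<mu> * h z)) \<in> dirichlet_space
     \<longleftrightarrow> set_integrable lborel (h ` unit_disk) (\<lambda>w. exp (2 * Re \<mu> * Re w))"
proof -
  let ?\<Omega> = "h ` unit_disk"
  have \<Omega>: "open ?\<Omega>"
    using h by (intro open_mapping_thm3) auto
  have hol: "(\<lambda>z. exp (\<mu> * h z)) holomorphic_on unit_disk"
    using h by (intro holomorphic_intros)
  have der: "(cmod (deriv (\<lambda>z. exp (\<mu> * h z)) z))\<^sup>2
      = (cmod \<mu>)\<^sup>2 * ((cmod (deriv h z))\<^sup>2 * exp (2 * Re (\<mu> * h z)))" if "z \<in> unit_disk" for z
  proof -
    have "((\<lambda>z. exp (\<mu> * h z)) has_field_derivative exp (\<mu> * h z) * (\<mu> * deriv h z)) (at z)"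
      using that by (auto intro!: derivative_eq_intros holomorphic_derivI[OF h(1)])
    then show ?thesis
      by (simp add: DERIV_imp_deriv norm_mult power_mult_distrib exp_double del: times_complex.sel)
  qed
  have "(\<lambda>z. exp (\<mu> * h z)) \<in> dirichlet_space
     \<longleftrightarrow> set_integrable lborel unit_disk (\<lambda>z. (cmod (deriv (\<lambda>z. exp (\<mu> * h z)) z))\<^sup>2)"
    using hol by (simp add: dirichlet_space_def)
  also have "\<dots> \<longleftrightarrow> set_integrable lborel unit_disk
      (\<lambda>z. (cmod \<mu>)\<^sup>2 * ((cmod (deriv h z))\<^sup>2 * exp (2 * Re (\<mu> * h z))))"
    by (intro set_integrable_cong refl der)
  also have "\<dots> \<longleftrightarrow> set_integrable lborel unit_disk
      (\<lambda>z. (cmod (deriv h z))\<^sup>2 * exp (2 * Re (\<mu> * h z)))"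
    using \<open>\<mu> \<noteq> 0\<close> by simp
  also have "\<dots> \<longleftrightarrow> set_integrable lborel ?\<Omega> (\<lambda>w. exp (2 * Re (\<mu> * w)))"
    using h by (intro set_integrable_conformal_image_iff continuous_intros) auto
  also have "\<dots> \<longleftrightarrow> set_integrable lborel ?\<Omega> (\<lambda>w. exp (2 * Re \<mu> * Re w))"
  proof -
    define K where "K = exp (2 * \<bar>Im \<mu>\<bar> * B)"
    have K: "exp (2 * Re (\<mu> * w)) \<le> K * exp (2 * Re \<mu> * Re w)"
      "exp (2 * Re \<mu> * Re w) \<le> K * exp (2 * Re (\<mu> * w))" if "w \<in> ?\<Omega>" for w
    proof -
      have "\<bar>Im \<mu> * Im w\<bar> \<le> \<bar>Im \<mu>\<bar> * B"
        using strip[OF that] by (simp add: abs_mult mult_left_mono)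
      then show "exp (2 * Re (\<mu> * w)) \<le> K * exp (2 * Re \<mu> * Re w)"
        "exp (2 * Re \<mu> * Re w) \<le> K * exp (2 * Re (\<mu> * w))"
        by (auto simp: K_def abs_le_iff mult.commute simp flip: exp_add)
    qed
    show ?thesis
    proof
      assume "set_integrable lborel ?\<Omega> (\<lambda>w. exp (2 * Re (\<mu> * w)))"
      then have "set_integrable lborel ?\<Omega> (\<lambda>w. K * exp (2 * Re (\<mu> * w)))"
        by simp
      then show "set_integrable lborel ?\<Omega> (\<lambda>w. exp (2 * Re \<mu> * Re w))"
        by (rule set_integrable_continuous_dominated) (use K \<Omega> in \<open>auto intro!: continuous_intros\<close>)
    next
      assume "set_integrable lborel ?\<Omega> (\<lambda>w. exp (2 * Re \<mu> * Re w))"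
      then have "set_integrable lborel ?\<Omega> (\<lambda>w. K * exp (2 * Re \<mu> * Re w))"
        by simp
      then show "set_integrable lborel ?\<Omega> (\<lambda>w. exp (2 * Re (\<mu> * w)))"
        by (rule set_integrable_continuous_dominated) (use K \<Omega> in \<open>auto intro!: continuous_intros\<close>)
    qed
  qed
  finally show ?thesis .
qed

section \<open>Eigenfunctions of the generator\<close>

lemma tendsto_real_difference_quotient:
  fixes F :: "complex \<Rightarrow> complex"
  assumes "(F has_field_derivative d) (at w)" and t: "filterlim t (at_right 0) net"
  shows "((\<lambda>n. (F (w + of_real (t n)) - F w) / of_real (t n)) \<longlongrightarrow> d) net"
proof -
  have "filterlim (\<lambda>n. complex_of_real (t n)) (at 0) net"
  proof (rule filterlim_atI)
    have "(t \<longlongrightarrow> 0) net"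
      using t by (simp add: filterlim_at)
    then show "((\<lambda>n. complex_of_real (t n)) \<longlongrightarrow> 0) net"
      using tendsto_of_real by fastforce
    show "\<forall>\<^sub>F n in net. complex_of_real (t n) \<noteq> 0"
      using t by (auto simp: filterlim_at elim: eventually_mono)
  qed
  moreover have "((\<lambda>s. (F (w + s) - F w) / s) \<longlongrightarrow> d) (at 0)"
    using assms(1) by (simp add: DERIV_def)
  ultimately show ?thesis
    by (rule filterlim_compose[rotated])
qed

text \<open>
  In the coordinate \<open>w = h z\<close> the semigroup consists of the translations \<open>w \<mapsto> w + t\<close>. With
  \<open>F = f \<circ> h\<^sup>-\<^sup>1\<close>, the difference quotients of the semigroup at \<open>f\<close> therefore converge pointwise to
  the derivative of \<open>F\<close>, by holomorphy alone. The eigenvalue equation holds in the Dirichlet norm, and the two limits have to be identified. Evaluation at \<open>0\<close> is part of the norm,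
  so \<open>F' = \<mu> F\<close> at \<open>h 0\<close>. The other part of the norm is an integral of the squared derivative, and
  by Fatou's lemma the pointwise limit of these derivatives vanishes almost everywhere, hence
  everywhere. Thus \<open>F' - \<mu> F\<close> is constant, and equal to its value 0 at \<open>h 0\<close>, and the linear
  equation \<open>F' = \<mu> F\<close> has the solutions \<open>C exp (\<mu> w)\<close> only.
\<close>

lemma generator_eigenfunction_eq_exp:
  assumes \<phi>: "holo_semigroup \<phi>" and koe: "koenigs_function \<phi> h"
    and gen: "dirichlet_generator (composition_semigroup \<phi>) f (\<lambda>z. \<mu> * f z)"
  shows "\<exists>C. \<forall>z\<in>unit_disk. f z = C * exp (\<mu> * h z)"
proof -
  let ?\<Omega> = "h ` unit_disk"
  have h: "h holomorphic_on unit_disk" "inj_on h unit_disk"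
    and shift: "\<And>t z. 0 \<le> t \<Longrightarrow> z \<in> unit_disk \<Longrightarrow> h (\<phi> t z) = h z + of_real t"
    using koe by (auto simp: koenigs_function_def)
  have \<phi>_disk: "\<phi> t z \<in> unit_disk" if "0 \<le> t" "z \<in> unit_disk" for t z
    using \<phi> that unfolding holo_semigroup_def by blast
  have \<Omega>: "open ?\<Omega>"
    using h by (intro open_mapping_thm3) auto
  have \<Omega>_shift: "w + of_real t \<in> ?\<Omega>" if "w \<in> ?\<Omega>" "0 \<le> t" for w t
  proof -
    obtain z where z: "z \<in> unit_disk" "w = h z"
      using \<open>w \<in> ?\<Omega>\<close> by blast
    then have "w + of_real t = h (\<phi> t z)" "\<phi> t z \<in> unit_disk"
      using shift \<phi>_disk \<open>0 \<le> t\<close> by auto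
    then show ?thesis by blast
  qed
  obtain g where g: "g holomorphic_on ?\<Omega>"
    and gh: "\<And>z. z \<in> unit_disk \<Longrightarrow> g (h z) = z"
    using holomorphic_has_inverse[OF h(1) open_ball h(2)] by metis
  have f: "f holomorphic_on unit_disk" "f \<in> dirichlet_space"
    using gen by (auto simp: dirichlet_generator_def dirichlet_space_def)

  define F where "F = f \<circ> g"
  have F: "F holomorphic_on ?\<Omega>"
    unfolding F_def using g f gh by (intro holomorphic_on_compose_gen[OF g f(1)]) auto
  have F': "deriv F holomorphic_on ?\<Omega>"
    using F \<Omega> by (intro holomorphic_deriv)
  have Fh: "F (h z) = f z" if "z \<in> unit_disk" for z
    using that by (simp add: F_def gh)
  have DF: "(F has_field_derivative deriv F w) (at w)"
    and DF': "(deriv F has_field_derivative deriv (deriv F) w) (at w)" if "w \<in> ?\<Omega>" for w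
    using that F F' \<Omega> by (auto intro: holomorphic_derivI)

  \<comment> \<open>The error \<open>Q t\<close> of the difference quotient tends to 0 in the Dirichlet norm. In the coordinate
    \<open>w = h z\<close>, its derivative is the corresponding error \<open>Q' t\<close> for the derivative of \<open>F\<close>.\<close>
  define Q where "Q t z = (composition_semigroup \<phi> t f z - f z) / of_real t - \<mu> * f z" for t z
  define Q' where "Q' t w = (deriv F (w + of_real t) - deriv F w) / of_real t - \<mu> * deriv F w" for t w
  have Q: "Q t z = (F (h z + of_real t) - F (h z)) / of_real t - \<mu> * F (h z)"
    if "z \<in> unit_disk" "0 < t" for t z
    using that Fh[OF \<phi>_disk[of t z]]
    by (simp add: Q_def composition_semigroup_def Fh shift)
  have dQ: "deriv (Q t) z = Q' t (h z) * deriv h z" if z: "z \<in> unit_disk" and t: "0 < t" for t z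
  proof -
    have w: "h z \<in> ?\<Omega>" "h z + of_real t \<in> ?\<Omega>"
      using z t \<Omega>_shift by auto
    have "((\<lambda>w. F (w + of_real t)) has_field_derivative deriv F (h z + of_real t)) (at (h z))"
      using DF[OF w(2)] by (simp add: DERIV_shift)
    then have "((\<lambda>w. (F (w + of_real t) - F w) / of_real t - \<mu> * F w) has_field_derivative Q' t (h z)) (at (h z))"
      unfolding Q'_def using DF[OF w(1)] t by (auto intro!: derivative_eq_intros)
    moreover have "(h has_field_derivative deriv h z) (at z)"
      using h(1) z by (intro holomorphic_derivI) auto
    ultimately have "((\<lambda>z. (F (h z + of_real t) - F (h z)) / of_real t - \<mu> * F (h z))
        has_field_derivative Q' t (h z) * deriv h z) (at z)"
      by (rule DERIV_chain2)
    moreover have "deriv (Q t) z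
        = deriv (\<lambda>z. (F (h z + of_real t) - F (h z)) / of_real t - \<mu> * F (h z)) z"
      using z t by (intro deriv_eq_on_open[of unit_disk] Q) auto
    ultimately show ?thesis
      by (simp add: DERIV_imp_deriv)
  qed

  from gen obtain \<epsilon> where "0 < \<epsilon>" and mem: "\<And>t. 0 < t \<Longrightarrow> t < \<epsilon> \<Longrightarrow>
      (\<lambda>z. (composition_semigroup \<phi> t f z - f z) / of_real t) \<in> dirichlet_space"
    by (auto simp: dirichlet_generator_def dirichlet_tendsto_def eventually_at_right_field)
  \<comment> \<open>Fatou's lemma needs a sequence; it stays below \<open>\<epsilon>\<close>, where the difference quotients are in the
    space.\<close>
  define t where "t n = \<epsilon> / (real n + 2)" for n
  have t: "0 < t n" "t n < \<epsilon>" for n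
    using \<open>0 < \<epsilon>\<close> by (auto simp: t_def field_simps add_pos_nonneg)
  have "t \<longlonglongrightarrow> 0"
    unfolding t_def by real_asymp
  with t(1) have t0: "filterlim t (at_right 0) sequentially"
    by (simp add: filterlim_at order_less_imp_not_eq2)
  have Q_mem: "Q (t n) \<in> dirichlet_space" for n
    unfolding Q_def using mem[OF t] f by (intro dirichlet_space_diff dirichlet_space_cmult) auto
  have "((\<lambda>t. dirichlet_norm (Q t)) \<longlongrightarrow> 0) (at_right 0)"
    using gen by (simp add: dirichlet_generator_def dirichlet_tendsto_def Q_def[abs_def])
  then have "(\<lambda>n. dirichlet_norm (Q (t n))) \<longlonglongrightarrow> 0"
    using t0 by (rule filterlim_compose)
  note lim = dirichlet_norm_tendsto_0D[OF Q_mem this]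

  define q where "q w = deriv F w - \<mu> * F w" for w
  have "(\<lambda>n. Q (t n) 0) \<longlonglongrightarrow> q (h 0)"
    unfolding q_def Q[OF centre_in_ball[THEN iffD2, OF zero_less_one] t(1)]
    by (intro tendsto_intros tendsto_real_difference_quotient[OF DF t0]) auto
  then have q0: "q (h 0) = 0"
    using lim(1) LIMSEQ_unique by blast

  \<comment> \<open>\<open>k\<close> is the derivative of \<open>q \<circ> h\<close>, obtained as the pointwise limit of the derivatives of the
    errors, whose Dirichlet integrals tend to 0.\<close>
  define k where "k z = (deriv (deriv F) (h z) - \<mu> * deriv F (h z)) * deriv h z" for z
  have k_lim: "(\<lambda>n. deriv (Q (t n)) z) \<longlonglongrightarrow> k z" if "z \<in> unit_disk" for z
    unfolding k_def dQ[OF that t(1)] Q'_def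
    using that by (intro tendsto_intros tendsto_real_difference_quotient[OF DF' t0]) auto
  define u where "u n z = ennreal ((cmod (deriv (Q (t n)) z))\<^sup>2) * indicator unit_disk z" for n z
  have u_meas: "u n \<in> borel_measurable lborel" for n
  proof -
    have "integrable lborel (\<lambda>z. indicator unit_disk z *\<^sub>R (cmod (deriv (Q (t n)) z))\<^sup>2)"
      using Q_mem[of n] by (simp add: dirichlet_space_def set_integrable_def)
    then have "(\<lambda>z. ennreal (indicator unit_disk z *\<^sub>R (cmod (deriv (Q (t n)) z))\<^sup>2)) \<in> borel_measurable lborel"
      by (intro measurable_compose[OF borel_measurable_integrable measurable_ennreal])
    then show ?thesis
      unfolding u_def by (simp add: ennreal_mult' ennreal_indicator mult.commute)
  qed
  have u_lim: "liminf (\<lambda>n. u n z) = ennreal ((cmod (k z))\<^sup>2) * indicator unit_disk z" for z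
  proof (cases "z \<in> unit_disk")
    case True
    have "(\<lambda>n. ennreal ((cmod (deriv (Q (t n)) z))\<^sup>2)) \<longlonglongrightarrow> ennreal ((cmod (k z))\<^sup>2)"
      by (intro tendsto_intros tendsto_ennrealI k_lim True)
    then show ?thesis
      using True by (simp add: u_def lim_imp_Liminf)
  qed (simp add: u_def Liminf_const)
  have "(\<integral>\<^sup>+ z. ennreal ((cmod (k z))\<^sup>2) * indicator unit_disk z \<partial>lborel)
      \<le> liminf (\<lambda>n. \<integral>\<^sup>+ z. u n z \<partial>lborel)"
    using nn_integral_liminf[of u lborel, OF u_meas] by (simp add: u_lim)
  also have "\<dots> = 0"
    unfolding u_def by (rule lim_imp_Liminf[OF _ lim(2)]) simp
  finally have int0: "(\<integral>\<^sup>+ z. ennreal ((cmod (k z))\<^sup>2) * indicator unit_disk z \<partial>lborel) = 0"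
    by simp
  have k_cont: "continuous_on unit_disk k"
  proof -
    have "deriv (deriv F) holomorphic_on ?\<Omega>"
      by (rule holomorphic_deriv[OF F' \<Omega>])
    then have "(\<lambda>w. deriv (deriv F) w - \<mu> * deriv F w) holomorphic_on ?\<Omega>"
      by (rule holomorphic_on_diff[OF _ holomorphic_on_mult[OF holomorphic_on_const F']])
    then have "((\<lambda>w. deriv (deriv F) w - \<mu> * deriv F w) \<circ> h) holomorphic_on unit_disk"
      using h(1) by (intro holomorphic_on_compose_gen[of h]) auto
    moreover have "deriv h holomorphic_on unit_disk"
      using h(1) by (intro holomorphic_deriv) auto
    ultimately have "k holomorphic_on unit_disk"
      unfolding k_def[abs_def] comp_def by (rule holomorphic_on_mult)
    then show ?thesis
      by (rule holomorphic_on_imp_continuous_on)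
  qed
  have k0: "k z = 0" if "z \<in> unit_disk" for z
  proof (rule continuous_AE_zero_imp_zero[OF _ k_cont _ that])
    have "(\<lambda>z. indicator unit_disk z *\<^sub>R (cmod (k z))\<^sup>2) \<in> borel_measurable borel"
      using k_cont by (intro borel_measurable_continuous_on_indicator continuous_intros) auto
    then have "(\<lambda>z. ennreal ((cmod (k z))\<^sup>2) * indicator unit_disk z) \<in> borel_measurable lborel"
      using measurable_compose[OF _ measurable_ennreal]
      by (fastforce simp: ennreal_mult' ennreal_indicator mult.commute)
    then have "AE z in lborel. ennreal ((cmod (k z))\<^sup>2) * indicator unit_disk z = 0"
      using int0 by (simp add: nn_integral_0_iff_AE)
    then show "AE z in lborel. z \<in> unit_disk \<longrightarrow> k z = 0"
      by (rule eventually_mono) (auto simp: indicator_def)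
  qed simp

  have q_deriv: "((\<lambda>z. q (h z)) has_field_derivative 0) (at z)" if z: "z \<in> unit_disk" for z
  proof -
    have "(q has_field_derivative deriv (deriv F) (h z) - \<mu> * deriv F (h z)) (at (h z))"
      unfolding q_def using z by (auto intro!: derivative_eq_intros DF DF')
    moreover have "(h has_field_derivative deriv h z) (at z)"
      using h(1) z by (intro holomorphic_derivI) auto
    ultimately have "((\<lambda>z. q (h z)) has_field_derivative k z) (at z)"
      unfolding k_def by (rule DERIV_chain2)
    with k0[OF z] show ?thesis by simp
  qed
  then obtain c where "\<forall>z\<in>unit_disk. q (h z) = c"
    using has_field_derivative_zero_constant[of unit_disk "\<lambda>z. q (h z)"]
    by (auto intro: has_field_derivative_at_within)
  with q0 have q_zero: "q (h z) = 0" if "z \<in> unit_disk" for z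
    using that by (metis centre_in_ball zero_less_one)

  have "((\<lambda>z. F (h z) * exp (- \<mu> * h z)) has_field_derivative 0) (at z)" if z: "z \<in> unit_disk" for z
  proof -
    have dh: "(h has_field_derivative deriv h z) (at z)"
      using h(1) z by (intro holomorphic_derivI) auto
    have "((\<lambda>z. F (h z)) has_field_derivative deriv F (h z) * deriv h z) (at z)"
      using z by (intro DERIV_chain2[OF DF dh]) auto
    moreover have "deriv F (h z) = \<mu> * F (h z)"
      using q_zero[OF z] by (simp add: q_def)
    ultimately show ?thesis
      using dh by (auto intro!: derivative_eq_intros simp: algebra_simps)
  qed
  then obtain C where C: "\<forall>z\<in>unit_disk. F (h z) * exp (- \<mu> * h z) = C"
    using has_field_derivative_zero_constant[of unit_disk "\<lambda>z. F (h z) * exp (- \<mu> * h z)"]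
    by (auto intro: has_field_derivative_at_within)
  have "f z = C * exp (\<mu> * h z)" if "z \<in> unit_disk" for z
    using C that by (auto simp: Fh exp_minus field_simps)
  then show ?thesis by blast
qed

text \<open>
  The semigroup multiplies \<open>exp (\<mu> * h z)\<close> by \<open>exp (\<mu> * t)\<close>, so every difference quotient is a
  scalar multiple of the function itself and norm convergence reduces to convergence of scalars.
\<close>

lemma exp_eigenfunction_of_generator:
  assumes koe: "koenigs_function \<phi> h" and f: "f = (\<lambda>z. exp (\<mu> * h z))" "f \<in> dirichlet_space"
  shows "dirichlet_generator (composition_semigroup \<phi>) f (\<lambda>z. \<mu> * f z)"
proof -
  define d where "d t = (exp (\<mu> * of_real t) - 1) / of_real t" for t :: real
  have quotient: "(composition_semigroup \<phi> t f z - f z) / of_real t = d t * f z"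
    if "0 < t" "z \<in> unit_disk" for t z
    using koe that by (simp add: koenigs_function_def composition_semigroup_def f(1) d_def
        exp_add distrib_left left_diff_distrib)
  have pos: "\<forall>\<^sub>F t in at_right 0. 0 < (t::real)"
    by (rule eventually_at_right_less)
  have "((\<lambda>s. exp (\<mu> * s)) has_field_derivative \<mu>) (at 0)"
    by (auto intro!: derivative_eq_intros)
  from tendsto_real_difference_quotient[OF this filterlim_ident]
  have "(d \<longlongrightarrow> \<mu>) (at_right 0)"
    by (simp add: d_def[abs_def])
  then have "((\<lambda>t. cmod (d t - \<mu>) * dirichlet_norm f) \<longlongrightarrow> cmod (\<mu> - \<mu>) * dirichlet_norm f) (at_right 0)"
    by (intro tendsto_intros)
  then have "((\<lambda>t. cmod (d t - \<mu>) * dirichlet_norm f) \<longlongrightarrow> 0) (at_right 0)"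
    by simp
  moreover have "\<forall>\<^sub>F t in at_right 0. cmod (d t - \<mu>) * dirichlet_norm f
      = dirichlet_norm (\<lambda>z. (composition_semigroup \<phi> t f z - f z) / of_real t - \<mu> * f z)"
    using pos
  proof (rule eventually_mono)
    fix t :: real assume "0 < t"
    then have "dirichlet_norm (\<lambda>z. (composition_semigroup \<phi> t f z - f z) / of_real t - \<mu> * f z)
        = dirichlet_norm (\<lambda>z. (d t - \<mu>) * f z)"
      by (intro dirichlet_cong(2)) (simp add: quotient left_diff_distrib)
    then show "cmod (d t - \<mu>) * dirichlet_norm f
        = dirichlet_norm (\<lambda>z. (composition_semigroup \<phi> t f z - f z) / of_real t - \<mu> * f z)"
      by (simp add: dirichlet_norm_cmult[OF f(2)])
  qed
  ultimately have "((\<lambda>t. dirichlet_norm (\<lambda>z. (composition_semigroup \<phi> t f z - f z) / of_real t - \<mu> * f z))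
      \<longlongrightarrow> 0) (at_right 0)"
    by (rule Lim_transform_eventually)
  moreover have "\<forall>\<^sub>F t in at_right 0. (\<lambda>z. (composition_semigroup \<phi> t f z - f z) / of_real t) \<in> dirichlet_space"
    using pos
  proof (rule eventually_mono)
    fix t :: real assume "0 < t"
    then show "(\<lambda>z. (composition_semigroup \<phi> t f z - f z) / of_real t) \<in> dirichlet_space"
      using dirichlet_space_cmult[OF f(2), of "d t"] by (subst dirichlet_cong(1)[OF quotient])
  qed
  ultimately show ?thesis
    using f(2) dirichlet_space_cmult[OF f(2), of \<mu>]
    by (simp add: dirichlet_generator_def dirichlet_tendsto_def)
qed

section \<open>The point spectrum\<close>

lemma const_1_mem_dirichlet_space: "(\<lambda>z. 1) \<in> dirichlet_space"
  by (simp add: dirichlet_space_def set_integrable_def)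

lemma zero_mem_dirichlet_point_spectrum:
  assumes "koenigs_function \<phi> h"
  shows "0 \<in> dirichlet_point_spectrum (composition_semigroup \<phi>)"
proof -
  have "dirichlet_generator (composition_semigroup \<phi>) (\<lambda>z. 1) (\<lambda>z. 0 * 1)"
    by (rule exp_eigenfunction_of_generator[OF assms, of _ 0]) (simp_all add: const_1_mem_dirichlet_space)
  moreover have "(0::complex) \<in> unit_disk"
    by simp
  ultimately show ?thesis
    unfolding dirichlet_point_spectrum_def
    by (intro CollectI exI[of _ "\<lambda>z. 1"]) (auto intro!: exI[of _ 0])
qed

lemma mem_dirichlet_point_spectrum_iff:
  assumes "holo_semigroup \<phi>" and koe: "koenigs_function \<phi> h" and "\<mu> \<noteq> 0"
  shows "\<mu> \<in> dirichlet_point_spectrum (composition_semigroup \<phi>)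
     \<longleftrightarrow> (\<lambda>z. exp (\<mu> * h z)) \<in> dirichlet_space"
proof
  assume "\<mu> \<in> dirichlet_point_spectrum (composition_semigroup \<phi>)"
  then obtain f z where gen: "dirichlet_generator (composition_semigroup \<phi>) f (\<lambda>z. \<mu> * f z)"
    and z: "z \<in> unit_disk" "f z \<noteq> 0"
    by (auto simp: dirichlet_point_spectrum_def)
  then obtain C where C: "\<forall>z\<in>unit_disk. f z = C * exp (\<mu> * h z)"
    using generator_eigenfunction_eq_exp[OF assms(1) koe] by blast
  with z have "C \<noteq> 0" by auto
  with C have "exp (\<mu> * h z) = inverse C * f z" if "z \<in> unit_disk" for z
    using that by simp
  moreover have "(\<lambda>z. inverse C * f z) \<in> dirichlet_space"
    using gen by (intro dirichlet_space_cmult) (simp add: dirichlet_generator_def)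
  ultimately show "(\<lambda>z. exp (\<mu> * h z)) \<in> dirichlet_space"
    by (subst dirichlet_cong(1)) auto
next
  assume "(\<lambda>z. exp (\<mu> * h z)) \<in> dirichlet_space"
  from exp_eigenfunction_of_generator[OF koe refl this]
  show "\<mu> \<in> dirichlet_point_spectrum (composition_semigroup \<phi>)"
    unfolding dirichlet_point_spectrum_def
    by (intro CollectI exI[of _ "\<lambda>z. exp (\<mu> * h z)"]) (auto intro!: exI[of _ 0])
qed

theorem theorem1p1:
  fixes \<phi> :: "real \<Rightarrow> complex \<Rightarrow> complex" and h :: "complex \<Rightarrow> complex"
    and \<Omega> :: "complex set" and a b :: real and \<psi> :: "real \<Rightarrow> ereal"
    and \<sigma> :: "complex set" and c\<^sub>\<Omega> :: ereal
  assumes "hyperbolic_semigroup \<phi>"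
    and "koenigs_function \<phi> h" and "\<Omega> = h ` unit_disk"
    and "a < b" and "defining_function \<Omega> {a<..<b} \<psi>"
    and "\<sigma> = dirichlet_point_spectrum (composition_semigroup \<phi>)"
    and "c\<^sub>\<Omega> = critical_exponent a b \<psi>"
  shows "(\<forall>\<mu>. \<mu> \<in> \<sigma> - {0} \<longleftrightarrow> Re \<mu> < 0 \<and> exp_integral a b \<psi> (Re \<mu>) < \<infinity>) \<and>
    (c\<^sub>\<Omega> = 0 \<longrightarrow> \<sigma> = {0}) \<and>
    (\<forall>c::real. c\<^sub>\<Omega> = ereal c \<and> c < 0 \<and> exp_integral a b \<psi> c = \<infinity> \<longrightarrow>
       \<sigma> = {\<mu>. c < Re \<mu> \<and> Re \<mu> < 0} \<union> {0}) \<and>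
    (\<forall>c::real. c\<^sub>\<Omega> = ereal c \<and> c < 0 \<and> exp_integral a b \<psi> c < \<infinity> \<longrightarrow>
       \<sigma> = {\<mu>. c \<le> Re \<mu> \<and> Re \<mu> < 0} \<union> {0}) \<and>
    (c\<^sub>\<Omega> = -\<infinity> \<longrightarrow> \<sigma> = {\<mu>. Re \<mu> < 0} \<union> {0})"
proof -
  have semigroup: "holo_semigroup \<phi>"
    using assms(1) by (simp add: hyperbolic_semigroup_def)
  have h: "h holomorphic_on unit_disk" "inj_on h unit_disk"
    using assms(2) by (auto simp: koenigs_function_def)
  have \<Omega>: "open \<Omega>"
    unfolding assms(3) using h by (intro open_mapping_thm3) auto
  have strip: "\<bar>Im w\<bar> \<le> \<bar>a\<bar> + \<bar>b\<bar>" if "w \<in> \<Omega>" for w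
    using that assms(5) by (auto simp: defining_function_def)
  let ?I = "exp_integral a b \<psi>"

  have spectrum: "\<mu> \<in> \<sigma> \<longleftrightarrow> \<mu> = 0 \<or> (Re \<mu> < 0 \<and> ?I (Re \<mu>) < \<infinity>)" for \<mu>
  proof (cases "\<mu> = 0")
    case True
    then show ?thesis
      using zero_mem_dirichlet_point_spectrum[OF assms(2)] assms(6) by simp
  next
    case False
    then have "\<mu> \<in> \<sigma> \<longleftrightarrow> (\<lambda>z. exp (\<mu> * h z)) \<in> dirichlet_space"
      using mem_dirichlet_point_spectrum_iff[OF semigroup assms(2)] assms(6) by simp
    also have "\<dots> \<longleftrightarrow> set_integrable lborel \<Omega> (\<lambda>w. exp (2 * Re \<mu> * Re w))"
      using exp_mult_mem_dirichlet_space_iff[OF h strip False] assms(3) by simp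
    also have "\<dots> \<longleftrightarrow> (\<integral>\<^sup>+ w. ennreal (exp (2 * Re \<mu> * Re w)) * indicator \<Omega> w \<partial>lborel) < \<infinity>"
      using \<Omega> by (intro set_integrable_nonneg_iff continuous_intros) auto
    also have "\<dots> \<longleftrightarrow> Re \<mu> < 0 \<and> ?I (Re \<mu>) < \<infinity>"
      by (rule domain_integral_finite_iff[OF assms(5) \<Omega> assms(4)])
    finally show ?thesis
      using False by simp
  qed
  have above: "?I x < \<infinity>" if x: "c\<^sub>\<Omega> < ereal x" "x < 0" for x
  proof -
    obtain c where "c \<le> 0" "?I c < \<infinity>" "c < x"
      using x(1) unfolding assms(7) critical_exponent_def INF_less_iff by auto
    then show ?thesis
      using exp_integral_finite_mono[OF assms(5) \<Omega>, of c x] x(2) by simp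
  qed
  have below: "c\<^sub>\<Omega> \<le> ereal x" if "x < 0" "?I x < \<infinity>" for x
    unfolding assms(7) critical_exponent_def using that by (intro INF_lower) auto

  have "\<sigma> = {0}" if "c\<^sub>\<Omega> = 0"
  proof -
    have "\<not> (Re \<mu> < 0 \<and> ?I (Re \<mu>) < \<infinity>)" for \<mu>
      using below[of "Re \<mu>"] that by auto
    then show ?thesis
      unfolding set_eq_iff spectrum by auto
  qed
  moreover have "\<sigma> = {\<mu>. c < Re \<mu> \<and> Re \<mu> < 0} \<union> {0}"
    if c: "c\<^sub>\<Omega> = ereal c" "?I c = \<infinity>" for c
  proof -
    have "Re \<mu> < 0 \<and> ?I (Re \<mu>) < \<infinity> \<longleftrightarrow> c < Re \<mu> \<and> Re \<mu> < 0" for \<mu>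
      using above[of "Re \<mu>"] below[of "Re \<mu>"] c by (cases "Re \<mu> = c") auto
    then show ?thesis
      unfolding set_eq_iff spectrum by auto
  qed
  moreover have "\<sigma> = {\<mu>. c \<le> Re \<mu> \<and> Re \<mu> < 0} \<union> {0}"
    if c: "c\<^sub>\<Omega> = ereal c" "?I c < \<infinity>" for c
  proof -
    have "Re \<mu> < 0 \<and> ?I (Re \<mu>) < \<infinity> \<longleftrightarrow> c \<le> Re \<mu> \<and> Re \<mu> < 0" for \<mu>
      using above[of "Re \<mu>"] below[of "Re \<mu>"] c by (cases "Re \<mu> = c") auto
    then show ?thesis
      unfolding set_eq_iff spectrum by auto
  qed
  moreover have "\<sigma> = {\<mu>. Re \<mu> < 0} \<union> {0}" if "c\<^sub>\<Omega> = - \<infinity>"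
  proof -
    have "Re \<mu> < 0 \<and> ?I (Re \<mu>) < \<infinity> \<longleftrightarrow> Re \<mu> < 0" for \<mu>
      using above[of "Re \<mu>"] that by auto
    then show ?thesis
      unfolding set_eq_iff spectrum by auto
  qed
  ultimately show ?thesis
    using spectrum by auto
qed

end
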